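(* For all real $a,b>0$ with $a\neq b$, $$\frac{\beta'(a)+\beta'(b)}{2}\le\frac{\beta(b)-\beta(a)}{b-a}\le\beta'\left(\frac{a+b}{2}\right).$$
   Context: Nielsen's $\beta$-function is the function $\beta:(0,\infty)\to\mathbb{R}$ defined by $\beta(x)=\int_0^1 \frac{t^{x-1}}{1+t}\,dt=\int_0^\infty\frac{e^{-xt}}{1+e^{-t}}\,dt$ for $x>0$; $\beta'$ denotes its derivative. *)

theory Defs
  imports "HOL-Analysis.Analysis"
begin

text \<open>Only the values at \<open>x > 0\<close> are meaningful: there the integrand is absolutely
  integrable, also for \<open>x < 1\<close>, where it is unbounded near 0. Its value at \<open>t = 0\<close>,
  which is 0 because of the convention \<open>0 powr y = 0\<close>, does not affect the integral.\<close>

definition nielsen_beta :: "real \<Rightarrow> real" where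
  "nielsen_beta x = integral {0..1} (\<lambda>t. t powr (x - 1) / (1 + t))"

end

theory Submission
  imports Defs "HOL-Real_Asymp.Real_Asymp"
begin

text \<open>
  The inequalities are the Hermite--Hadamard inequalities for the derivative \<open>\<beta>'\<close> on the interval
  between \<open>a\<close> and \<open>b\<close>: the middle term is the mean value of \<open>\<beta>'\<close> there, so everything follows
  once \<open>\<beta>'\<close> is known to be concave on the positive reals.

  Differentiation under the integral sign is avoided by identifying \<open>\<beta>\<close> with
  \<open>D x = (\<psi>((x + 1) / 2) - \<psi>(x / 2)) / 2\<close>, where \<open>\<psi>\<close> is the digamma function. Both functions are
  nonnegative and satisfy \<open>f x + f (x + 1) = 1 / x\<close>, and only one function on the positive reals
  can do so (\<open>nonneg_alternating_recurrence_unique\<close>). All derivatives of \<open>D\<close> are then differences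
  of polygamma functions. In particular \<open>D'''\<close> is, up to a factor of \<open>1 / 16\<close>, the difference of
  \<open>\<psi>'''\<close> at \<open>(x + 1) / 2\<close> and at \<open>x / 2\<close>, which is negative because \<open>\<psi>'''\<close> decreases.
\<close>

text \<open>The middle term is the mean value of \<open>f\<close> over the interval, since \<open>F\<close> is an antiderivative.
  A concave function lies above its chord, which gives the first inequality; its average over two
  points symmetric about the midpoint is at most its value there, which gives the second.\<close>

lemma Hermite_Hadamard_concave:
  fixes f F :: "real \<Rightarrow> real"
  assumes "a < b" and conc: "concave_on {a..b} f"
    and F: "\<And>x. x \<in> {a..b} \<Longrightarrow> (F has_real_derivative f x) (at x)"
  shows "(f a + f b) / 2 \<le> (F b - F a) / (b - a)"
    and "(F b - F a) / (b - a) \<le> f ((a + b) / 2)"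
proof -
  define k where "k = (f b - f a) / (b - a)"
  \<comment> \<open>\<open>F\<close> minus an antiderivative of the chord is nondecreasing.\<close>
  have "F a - (f a * a + k * (a - a)\<^sup>2 / 2) \<le> F b - (f a * b + k * (b - a)\<^sup>2 / 2)"
  proof (rule DERIV_nonneg_imp_nondecreasing[where f = "\<lambda>x. F x - (f a * x + k * (x - a)\<^sup>2 / 2)"])
    fix x assume x: "a \<le> x" "x \<le> b"
    have "((\<lambda>x. F x - (f a * x + k * (x - a)\<^sup>2 / 2)) has_real_derivative
            f x - (f a + k * (x - a))) (at x)"
      using x by (auto intro!: derivative_eq_intros F)
    moreover have "f x \<ge> k * (x - a) + f a"
      unfolding k_def using concave_onD_Icc'[OF conc, of x] x by simp
    ultimately show "\<exists>y. ((\<lambda>x. F x - (f a * x + k * (x - a)\<^sup>2 / 2)) has_real_derivative y) (at x)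
                        \<and> y \<ge> 0"
      by (intro exI[of _ "f x - (f a + k * (x - a))"]) auto
  qed (use \<open>a < b\<close> in simp)
  moreover have "k * (b - a)\<^sup>2 = (f b - f a) * (b - a)"
    using \<open>a < b\<close> by (simp add: k_def power2_eq_square)
  ultimately have "(f a + f b) / 2 * (b - a) \<le> F b - F a"
    by (simp add: field_simps)
  then show "(f a + f b) / 2 \<le> (F b - F a) / (b - a)"
    using \<open>a < b\<close> by (simp add: pos_le_divide_eq)

  define m where "m = (a + b) / 2"
  define h where "h = (b - a) / 2"
  have "F (m + h) - F (m - h) - 2 * h * f m \<le> F (m + 0) - F (m - 0) - 2 * 0 * f m"
  proof (rule DERIV_nonpos_imp_nonincreasing[where f = "\<lambda>t. F (m + t) - F (m - t) - 2 * t * f m"])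
    fix t assume t: "0 \<le> t" "t \<le> h"
    have mem: "m + t \<in> {a..b}" "m - t \<in> {a..b}"
      using t by (simp_all add: m_def h_def field_simps)
    have d: "((\<lambda>t. F (m + t)) has_real_derivative f (m + t)) (at t)"
    proof -
      have "((\<lambda>t. m + t) has_real_derivative 1) (at t)"
        by (auto intro!: derivative_eq_intros)
      from DERIV_chain2[where f = F, OF F[OF mem(1)] this] show ?thesis
        by simp
    qed
    have d': "((\<lambda>t. F (m - t)) has_real_derivative - f (m - t)) (at t)"
    proof -
      have "((\<lambda>t. m - t) has_real_derivative - 1) (at t)"
        by (auto intro!: derivative_eq_intros)
      from DERIV_chain2[where f = F, OF F[OF mem(2)] this] show ?thesis
        by simp
    qed
    have "((\<lambda>t. F (m + t) - F (m - t) - 2 * t * f m) has_real_derivative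
            f (m + t) + f (m - t) - 2 * f m) (at t)"
      by (auto intro!: derivative_eq_intros d d')
    moreover have "f (m + t) + f (m - t) \<le> 2 * f m"
      using concave_onD[OF conc _ _ mem, of "1 / 2"] by (simp add: field_simps)
    ultimately show "\<exists>y. ((\<lambda>t. F (m + t) - F (m - t) - 2 * t * f m) has_real_derivative y) (at t)
                        \<and> y \<le> 0"
      by (intro exI[of _ "f (m + t) + f (m - t) - 2 * f m"]) auto
  qed (use \<open>a < b\<close> in \<open>simp add: h_def\<close>)
  moreover have "m + h = b" "m - h = a" "2 * h = b - a"
    by (simp_all add: m_def h_def field_simps)
  ultimately have "F b - F a \<le> f m * (b - a)"
    by (simp add: mult.commute)
  then show "(F b - F a) / (b - a) \<le> f ((a + b) / 2)"
    using \<open>a < b\<close> by (simp add: pos_divide_le_eq m_def)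
qed

text \<open>Two solutions lie between \<open>0\<close> and \<open>1 / x\<close>, so their difference tends to \<open>0\<close> at infinity;
  as that difference only changes sign under \<open>x \<mapsto> x + 1\<close>, it vanishes everywhere.\<close>

lemma nonneg_alternating_recurrence_unique:
  fixes f g :: "real \<Rightarrow> real"
  assumes f: "\<And>x. x > 0 \<Longrightarrow> f x + f (x + 1) = 1 / x" "\<And>x. x > 0 \<Longrightarrow> f x \<ge> 0"
    and g: "\<And>x. x > 0 \<Longrightarrow> g x + g (x + 1) = 1 / x" "\<And>x. x > 0 \<Longrightarrow> g x \<ge> 0"
    and "x > 0"
  shows "f x = g x"
proof -
  have shift: "\<bar>f (x + real n) - g (x + real n)\<bar> = \<bar>f x - g x\<bar>" for n
  proof (induction n)
    case (Suc n)
    have "x + real n > 0" using \<open>x > 0\<close> by simp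
    from f(1)[OF this] g(1)[OF this] Suc show ?case
      by (simp add: algebra_simps)
  qed simp
  have bound: "\<bar>f y - g y\<bar> \<le> 1 / y" if "y > 0" for y
    using f(1)[OF that] g(1)[OF that] f(2)[of y] f(2)[of "y + 1"] g(2)[of y] g(2)[of "y + 1"] that
    by linarith
  have "\<bar>f x - g x\<bar> \<le> 1 / (x + real n)" for n
    using shift[of n] bound[of "x + real n"] \<open>x > 0\<close> by simp
  moreover have "(\<lambda>n. 1 / (x + real n)) \<longlonglongrightarrow> 0"
    by real_asymp
  ultimately have "\<bar>f x - g x\<bar> \<le> 0"
    by (intro LIMSEQ_le_const) auto
  then show ?thesis by simp
qed

lemma nielsen_beta_integrable:
  assumes "x > 0"
  shows "(\<lambda>t::real. t powr (x - 1) / (1 + t)) integrable_on {0..1}"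
proof -
  have "(\<lambda>t::real. inverse (1 + t) * t powr (x - 1)) absolutely_integrable_on {0..1}"
  proof (rule absolutely_integrable_bounded_measurable_product_real)
    have cont: "continuous_on {0..1} (\<lambda>t::real. inverse (1 + t))"
      by (intro continuous_intros) auto
    then show "(\<lambda>t::real. inverse (1 + t)) \<in> borel_measurable (lebesgue_on {0..1})"
      by (intro continuous_imp_measurable_on_sets_lebesgue) auto
    show "bounded ((\<lambda>t::real. inverse (1 + t)) ` {0..1})"
      by (intro compact_imp_bounded compact_continuous_image cont) auto
    show "(\<lambda>t::real. t powr (x - 1)) absolutely_integrable_on {0..1}"
      using assms by (intro nonnegative_absolutely_integrable_1 integrable_on_powr_from_0) auto
  qed simp
  then show ?thesis
    by (simp add: absolutely_integrable_on_def divide_inverse mult.commute)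
qed

lemma nielsen_beta_nonneg:
  assumes "x > 0"
  shows "nielsen_beta x \<ge> 0"
  unfolding nielsen_beta_def
  by (intro integral_nonneg nielsen_beta_integrable assms) auto

text \<open>Adding the integrands cancels the denominator, as
  \<open>t powr (x - 1) + t powr x = t powr (x - 1) * (1 + t)\<close>.\<close>

lemma nielsen_beta_recurrence:
  assumes "x > 0"
  shows "nielsen_beta x + nielsen_beta (x + 1) = 1 / x"
proof -
  have "nielsen_beta x + nielsen_beta (x + 1) =
      integral {0..1} (\<lambda>t. t powr (x - 1) / (1 + t) + t powr ((x + 1) - 1) / (1 + t))"
    unfolding nielsen_beta_def using assms
    by (intro integral_add[symmetric] nielsen_beta_integrable) auto
  also have "\<dots> = integral {0..1} (\<lambda>t. t powr (x - 1))"
  proof (rule integral_cong)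
    fix t :: real assume t: "t \<in> {0..1}"
    then have "t powr x = t powr (x - 1) * t"
      using powr_add[of t "x - 1" 1] by simp
    then have "t powr (x - 1) + t powr x = t powr (x - 1) * (1 + t)"
      by (simp add: algebra_simps)
    then show "t powr (x - 1) / (1 + t) + t powr ((x + 1) - 1) / (1 + t) = t powr (x - 1)"
      using t by (simp flip: add_divide_distrib)
  qed
  also have "\<dots> = 1 / x"
    using has_integral_powr_from_0[of "x - 1" 1] assms by (intro integral_unique) auto
  finally show ?thesis .
qed

text \<open>For \<open>n = 0\<close> this is \<open>\<beta>\<close> itself, and each derivative raises the index by one.\<close>

definition nielsen_polygamma :: "nat \<Rightarrow> real \<Rightarrow> real" where
  "nielsen_polygamma n x = (Polygamma n ((x + 1) / 2) - Polygamma n (x / 2)) / 2 ^ Suc n"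

lemma has_derivative_nielsen_polygamma:
  assumes "x > 0"
  shows "(nielsen_polygamma n has_real_derivative nielsen_polygamma (Suc n) x) (at x)"
proof -
  have "x / 2 \<notin> \<int>\<^sub>\<le>\<^sub>0" "(x + 1) / 2 \<notin> \<int>\<^sub>\<le>\<^sub>0"
    using assms by (auto elim!: nonpos_Ints_cases)
  then have "((\<lambda>x. (Polygamma n ((x + 1) / 2) - Polygamma n (x / 2)) / 2 ^ Suc n)
      has_real_derivative nielsen_polygamma (Suc n) x) (at x)"
    by (auto intro!: derivative_eq_intros simp: nielsen_polygamma_def field_simps)
  then show ?thesis
    by (simp add: nielsen_polygamma_def[abs_def])
qed

text \<open>In \<open>D x + D (x + 1)\<close> the value \<open>\<psi>((x + 1) / 2)\<close> cancels, and \<open>\<psi>(z + 1) - \<psi>(z) = 1 / z\<close> at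
  \<open>z = x / 2\<close> gives the recurrence; \<open>D\<close> is nonnegative because \<open>\<psi>\<close> increases.\<close>

lemma nielsen_beta_eq_Digamma:
  assumes "x > 0"
  shows "nielsen_beta x = nielsen_polygamma 0 x"
proof (rule nonneg_alternating_recurrence_unique[OF nielsen_beta_recurrence nielsen_beta_nonneg])
  fix y :: real assume y: "y > 0"
  have "(y + 1 + 1) / 2 = y / 2 + 1"
    by simp
  then show "nielsen_polygamma 0 y + nielsen_polygamma 0 (y + 1) = 1 / y"
    using y Digamma_plus1[of "y / 2"] by (simp add: nielsen_polygamma_def field_simps)
  show "nielsen_polygamma 0 y \<ge> 0"
    using y Digamma_real_mono[of "y / 2" "(y + 1) / 2"] by (simp add: nielsen_polygamma_def)
qed (use assms in auto)

lemma nielsen_beta_has_derivative: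
  assumes "x > 0"
  shows "(nielsen_beta has_real_derivative nielsen_polygamma 1 x) (at x)"
proof (rule has_field_derivative_transform_within_open)
  show "(nielsen_polygamma 0 has_real_derivative nielsen_polygamma 1 x) (at x)"
    using has_derivative_nielsen_polygamma[OF assms, of 0] by simp
qed (use assms in \<open>auto simp: nielsen_beta_eq_Digamma intro: open_greaterThan[of 0]\<close>)

lemma concave_nielsen_beta_deriv: "concave_on {0<..} (nielsen_polygamma 1)"
proof (rule f''_le0_imp_concave)
  fix x :: real assume "x \<in> {0<..}"
  then have x: "x > 0" by simp
  show "(nielsen_polygamma 1 has_real_derivative nielsen_polygamma 2 x) (at x)"
    using has_derivative_nielsen_polygamma[OF x, of 1] by (simp add: numeral_2_eq_2)
  show "(nielsen_polygamma 2 has_real_derivative nielsen_polygamma 3 x) (at x)"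
    using has_derivative_nielsen_polygamma[OF x, of 2] by (simp add: numeral_3_eq_3 numeral_2_eq_2)
  show "nielsen_polygamma 3 x \<le> 0"
    using x Polygamma_real_strict_antimono[of "x / 2" "(x + 1) / 2" 3]
    by (simp add: nielsen_polygamma_def)
qed simp

theorem theorem2p6:
  fixes a b :: real
  assumes "a > 0" and "b > 0" and "a \<noteq> b"
  shows "(deriv nielsen_beta a + deriv nielsen_beta b) / 2
           \<le> (nielsen_beta b - nielsen_beta a) / (b - a)
       \<and> (nielsen_beta b - nielsen_beta a) / (b - a)
           \<le> deriv nielsen_beta ((a + b) / 2)"
proof -
  have deriv: "deriv nielsen_beta x = nielsen_polygamma 1 x" if "x > 0" for x
    using nielsen_beta_has_derivative[OF that] by (rule DERIV_imp_deriv)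
  have ordered: "(deriv nielsen_beta u + deriv nielsen_beta v) / 2
           \<le> (nielsen_beta v - nielsen_beta u) / (v - u)
       \<and> (nielsen_beta v - nielsen_beta u) / (v - u)
           \<le> deriv nielsen_beta ((u + v) / 2)" if uv: "0 < u" "u < v" for u v
  proof -
    have "concave_on {u..v} (nielsen_polygamma 1)"
      using concave_nielsen_beta_deriv uv
      by (auto simp: concave_on_def intro: convex_on_subset)
    moreover have "(nielsen_beta has_real_derivative nielsen_polygamma 1 x) (at x)"
      if "x \<in> {u..v}" for x
      using that uv by (intro nielsen_beta_has_derivative) auto
    ultimately show ?thesis
      using Hermite_Hadamard_concave[OF uv(2), of "nielsen_polygamma 1" nielsen_beta] uv
      by (simp only: deriv add_pos_pos half_gt_zero)
  qed
  \<comment> \<open>All three expressions are symmetric in \<open>a\<close> and \<open>b\<close>.\<close>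
  show ?thesis
  proof (cases "a < b")
    case False
    have "(nielsen_beta b - nielsen_beta a) / (b - a) = (nielsen_beta a - nielsen_beta b) / (a - b)"
      using minus_divide_divide[of "nielsen_beta a - nielsen_beta b" "a - b"] by simp
    then show ?thesis
      using ordered[of b a] False assms by (simp add: add.commute)
  qed (use ordered assms in blast)
qed

end
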